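(* Let $\Gamma=\{\pi_\alpha:\alpha\in[\alpha_1,\alpha_2]\}$ be the class of prior distributions (densities on $\Theta$) for the natural parameter $\theta$ of the exponential family $f(x|\theta)=\beta(\theta)t(x)e^{-\theta r(x)}$, and let $H=\beta'/\beta$. Suppose the Bayes estimator $\Psi(\alpha,x)=H^{-1}\{E[H(\theta)|x]\}$ under the prior $\pi_\alpha$ is a differentiable function of the hyper-parameter $\alpha$ and the observed value $x$. Assume that $\int_\Theta|H(\theta)|f(x|\theta)\,d\theta$ exists and is finite, and that $\alpha_n\to\alpha$ implies $\sup_{\theta\in\Theta}|\pi_{\alpha_n}(\theta)-\pi_\alpha(\theta)|\to0$. If $$\frac{\partial}{\partial x}\Psi(\alpha,x)=\frac{\partial}{\partial x}\left\{\frac{\Psi(\alpha_1,x)\,H(\Psi(\alpha_1,x))-\Psi(\alpha_2,x)\,H(\Psi(\alpha_2,x))-\log\frac{\beta(\Psi(\alpha_1,x))}{\beta(\Psi(\alpha_2,x))}}{H(\Psi(\alpha_1,x))-H(\Psi(\alpha_2,x))}\right\}$$ has a constant solution in $\alpha$, then there is a data-independent prior $\pi_\alpha\in\Gamma$ resulting in the posterior regret gamma-minimax (PRGM) estimate as the Bayes estimate of $\theta$ under the intrinsic loss function $L(\theta,\delta)=E_\theta[\log(f(X|\theta)/f(X|\delta))]$.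
   Context: Setting. $X$ is a random variable whose distribution belongs to the one-parameter exponential family $\{f(x|\theta):x\in\chi\subseteq\mathbb{R},\ \theta\in\Theta\subseteq\mathbb{R}\}$ with density $f(x|\theta)=\beta(\theta)t(x)e^{-\theta r(x)}$ (with respect to Lebesgue or counting measure), where $r(x)>0$ and $\beta(\theta)t(x)>0$. The function $H=\beta'/\beta$ satisfies $H(\theta)=E_\theta[r(X)]$ and is decreasing. For this family the intrinsic loss is $L(\theta,\delta)=\log\frac{\beta(\theta)}{\beta(\delta)}+(\delta-\theta)H(\theta)$, $\theta,\delta\in\Theta$. For a prior $\pi$ with posterior $\pi(\cdot|x)$, the posterior risk of $\delta(x)$ is $r(x,\delta)=E[L(\theta,\delta(x))|x]$. It is minimized by the Bayes estimator $\delta_\pi(x)=H^{-1}\{E(H(\theta)|x)\}$. The posterior regret is $\rho(\delta_\pi,\delta)=r(x,\delta)-r(x,\delta_\pi)$. The PRGM estimator over $\Gamma$ is a $\delta_{PR}$ with $\sup_{\pi\in\Gamma}\rho(\delta_\pi(x),\delta_{PR}(x))=\inf_\delta\sup_{\pi\in\Gamma}\rho(\delta_\pi(x),\delta(x))$. "Data-independent" means that the hyper-parameter $\alpha$ of the prior does not depend on the observed value $x$; a "constant solution in $\alpha$" is a solution $\alpha$ not depending on $x$.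
   Formalization: Two tacit hypotheses are added, without which the claim fails: Ψ(α,x) lies between Ψ(α₁,x) and Ψ(α₂,x) for all α and x, and the constant solution α makes Ψ(α,x₀) equal the bracketed quotient at some x₀ (zero integration constant). *)

theory Defs
  imports "HOL-Probability.Probability"
begin

definition expfam_density ::
  "(real \<Rightarrow> real) \<Rightarrow> (real \<Rightarrow> real) \<Rightarrow> (real \<Rightarrow> real) \<Rightarrow> real \<Rightarrow> real \<Rightarrow> real"
  where "expfam_density \<beta> t r \<theta> x = \<beta> \<theta> * t x * exp (- \<theta> * r x)"

definition sampling_distribution ::
  "real measure \<Rightarrow> (real \<Rightarrow> real) \<Rightarrow> (real \<Rightarrow> real) \<Rightarrow> (real \<Rightarrow> real) \<Rightarrow> real \<Rightarrow> real measure"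
  where "sampling_distribution \<nu> \<beta> t r \<theta> = density \<nu> (\<lambda>x. ennreal (expfam_density \<beta> t r \<theta> x))"

text \<open>The derivative is taken within the parameter interval, so that the parameter interval may
  contain its end points; on an open interval it is the ordinary derivative.\<close>

definition H_fun :: "real set \<Rightarrow> (real \<Rightarrow> real) \<Rightarrow> real \<Rightarrow> real"
  where "H_fun \<Theta> \<beta> \<theta> = vector_derivative \<beta> (at \<theta> within \<Theta>) / \<beta> \<theta>"

definition intrinsic_loss ::
  "real measure \<Rightarrow> (real \<Rightarrow> real) \<Rightarrow> (real \<Rightarrow> real) \<Rightarrow> (real \<Rightarrow> real) \<Rightarrow> real \<Rightarrow> real \<Rightarrow> real"
  where "intrinsic_loss \<nu> \<beta> t r \<theta> \<delta> =
    (\<integral>x. ln (expfam_density \<beta> t r \<theta> x / expfam_density \<beta> t r \<delta> x)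
       \<partial>sampling_distribution \<nu> \<beta> t r \<theta>)"

definition posterior_density ::
  "real set \<Rightarrow> (real \<Rightarrow> real) \<Rightarrow> (real \<Rightarrow> real) \<Rightarrow> (real \<Rightarrow> real) \<Rightarrow> (real \<Rightarrow> real)
    \<Rightarrow> real \<Rightarrow> real \<Rightarrow> real"
  where "posterior_density \<Theta> \<beta> t r p x \<theta> =
    expfam_density \<beta> t r \<theta> x * p \<theta> / (LINT \<tau>:\<Theta>|lborel. expfam_density \<beta> t r \<tau> x * p \<tau>)"

definition posterior_expectation ::
  "real set \<Rightarrow> (real \<Rightarrow> real) \<Rightarrow> (real \<Rightarrow> real) \<Rightarrow> (real \<Rightarrow> real) \<Rightarrow> (real \<Rightarrow> real)
    \<Rightarrow> real \<Rightarrow> (real \<Rightarrow> real) \<Rightarrow> real"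
  where "posterior_expectation \<Theta> \<beta> t r p x g =
    (LINT \<theta>:\<Theta>|lborel. g \<theta> * posterior_density \<Theta> \<beta> t r p x \<theta>)"

definition posterior_risk ::
  "real measure \<Rightarrow> real set \<Rightarrow> (real \<Rightarrow> real) \<Rightarrow> (real \<Rightarrow> real) \<Rightarrow> (real \<Rightarrow> real) \<Rightarrow> (real \<Rightarrow> real)
    \<Rightarrow> real \<Rightarrow> real \<Rightarrow> real"
  where "posterior_risk \<nu> \<Theta> \<beta> t r p x d =
    posterior_expectation \<Theta> \<beta> t r p x (\<lambda>\<theta>. intrinsic_loss \<nu> \<beta> t r \<theta> d)"

definition bayes_estimator ::
  "real set \<Rightarrow> (real \<Rightarrow> real) \<Rightarrow> (real \<Rightarrow> real) \<Rightarrow> (real \<Rightarrow> real) \<Rightarrow> (real \<Rightarrow> real) \<Rightarrow> real \<Rightarrow> real"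
  where "bayes_estimator \<Theta> \<beta> t r p x =
    inv_into \<Theta> (H_fun \<Theta> \<beta>) (posterior_expectation \<Theta> \<beta> t r p x (H_fun \<Theta> \<beta>))"

definition posterior_regret ::
  "real measure \<Rightarrow> real set \<Rightarrow> (real \<Rightarrow> real) \<Rightarrow> (real \<Rightarrow> real) \<Rightarrow> (real \<Rightarrow> real) \<Rightarrow> (real \<Rightarrow> real)
    \<Rightarrow> real \<Rightarrow> real \<Rightarrow> real"
  where "posterior_regret \<nu> \<Theta> \<beta> t r p x d =
    posterior_risk \<nu> \<Theta> \<beta> t r p x d
      - posterior_risk \<nu> \<Theta> \<beta> t r p x (bayes_estimator \<Theta> \<beta> t r p x)"

text \<open>The condition is pointwise in the observation, so the infimum over estimators is an
  infimum over the values in the parameter space that they can take there.  Extended reals keep an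
  unbounded supremum meaningful.\<close>

definition is_PRGM ::
  "real measure \<Rightarrow> real set \<Rightarrow> (real \<Rightarrow> real) \<Rightarrow> (real \<Rightarrow> real) \<Rightarrow> (real \<Rightarrow> real)
    \<Rightarrow> (real \<Rightarrow> real) set \<Rightarrow> (real \<Rightarrow> real) \<Rightarrow> bool"
  where "is_PRGM \<nu> \<Theta> \<beta> t r \<Gamma> \<delta> \<longleftrightarrow>
    (\<forall>x\<in>space \<nu>. \<delta> x \<in> \<Theta> \<and>
      (SUP p\<in>\<Gamma>. ereal (posterior_regret \<nu> \<Theta> \<beta> t r p x (\<delta> x)))
        = (INF d\<in>\<Theta>. SUP p\<in>\<Gamma>. ereal (posterior_regret \<nu> \<Theta> \<beta> t r p x d)))"

text \<open>With \<open>u\<close> and \<open>v\<close> the Bayes estimates under the priors with the extreme hyper-parameters, this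
  is the action at which those two priors have equal posterior regret.\<close>

definition equal_regret_action :: "real set \<Rightarrow> (real \<Rightarrow> real) \<Rightarrow> real \<Rightarrow> real \<Rightarrow> real"
  where "equal_regret_action \<Theta> \<beta> u v =
    (u * H_fun \<Theta> \<beta> u - v * H_fun \<Theta> \<beta> v - ln (\<beta> u / \<beta> v)) / (H_fun \<Theta> \<beta> u - H_fun \<Theta> \<beta> v)"

end

theory Submission
  imports Defs
begin

text \<open>Write \<open>g\<close> for \<open>log \<beta>\<close>, so that \<open>g' = H\<close> and \<open>g\<close> is concave. The intrinsic loss is the Bregman
  gap \<open>g \<theta> - g \<delta> + (\<delta> - \<theta>) H \<theta>\<close>, hence the posterior regret of \<open>\<delta>\<close> is the gap between the Bayes
  estimate and \<open>\<delta>\<close>; in particular it is nonnegative. The gap between \<open>p\<close> and \<open>w\<close> grows as either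
  point moves away from the other. So for \<open>w\<close> between the extreme Bayes estimates \<open>u\<close> and \<open>v\<close> with
  equal gaps to both, the worst prior is an extreme one, and moving \<open>w\<close> increases the gap to \<open>u\<close> or to
  \<open>v\<close>: such a \<open>w\<close> is minimax. The differential equation and the initial value say that
  \<open>\<Psi> \<alpha>\<close> is this \<open>w\<close> for every observation.\<close>

section \<open>Bregman gaps of concave functions\<close>

text \<open>With \<open>h\<close> the derivative of \<open>g\<close>, this is the height at
  \<open>d\<close> of the tangent at \<open>p\<close> above the graph of \<open>g\<close>.\<close>

definition bregman_gap :: "(real \<Rightarrow> real) \<Rightarrow> (real \<Rightarrow> real) \<Rightarrow> real \<Rightarrow> real \<Rightarrow> real"
  where "bregman_gap g h p d = g p - g d + (d - p) * h p"

locale decreasing_derivative =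
  fixes S :: "real set" and g h :: "real \<Rightarrow> real"
  assumes interval: "is_interval S"
    and deriv: "\<And>y. y \<in> S \<Longrightarrow> (g has_real_derivative h y) (at y within S)"
    and strict_decreasing: "strict_antimono_on S h"
begin

lemma decreasing: "a \<in> S \<Longrightarrow> b \<in> S \<Longrightarrow> a \<le> b \<Longrightarrow> h b \<le> h a"
  using strict_decreasing by (fastforce simp: monotone_on_def le_less)

lemma inj_on_derivative: "inj_on h S"
  using strict_decreasing by (simp add: strict_antimono_iff_antimono)

lemma segment_subset: "a \<in> S \<Longrightarrow> b \<in> S \<Longrightarrow> {a..b} \<subseteq> S"
  by (auto intro: mem_is_interval_1_I[OF interval, of a b])

lemma mean_value:
  assumes "a \<in> S" "b \<in> S" "a \<le> b"
  obtains c where "c \<in> {a..b}" "g b - g a = h c * (b - a)"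
proof -
  have "(g has_derivative (*) (h y)) (at y within {a..b})" if "a \<le> y" "y \<le> b" for y
    using has_field_derivative_subset[OF deriv segment_subset[OF assms(1,2)], of y]
      segment_subset[OF assms(1,2)] that
    by (auto simp: has_field_derivative_def)
  from mvt_very_simple[OF \<open>a \<le> b\<close> this] show thesis
    using that by auto
qed

text \<open>The chord slope is \<open>h c\<close> for some \<open>c\<close> between the points;
  monotonicity compares it with \<open>h a\<close> in the direction set by the sign of
  \<open>b - a\<close>.\<close>

lemma below_tangent:
  assumes "a \<in> S" "b \<in> S"
  shows "g b - g a \<le> (b - a) * h a"
proof (cases "a \<le> b")
  case True
  obtain c where c: "c \<in> {a..b}" "g b - g a = h c * (b - a)"
    using mean_value[OF assms True] .
  then have "h c \<le> h a"
    using segment_subset[OF assms] assms by (intro decreasing) auto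
  then show ?thesis
    using c True by (simp add: mult_right_mono mult.commute)
next
  case False
  then have le: "b \<le> a" by simp
  obtain c where c: "c \<in> {b..a}" "g a - g b = h c * (a - b)"
    using mean_value[OF assms(2,1) le] .
  then have "h a \<le> h c"
    using segment_subset[OF assms(2,1)] assms by (intro decreasing) auto
  then have "h a * (a - b) \<le> h c * (a - b)"
    using le by (simp add: mult_right_mono)
  then show ?thesis
    using c by (simp add: algebra_simps)
qed

lemma bregman_gap_nonneg: "p \<in> S \<Longrightarrow> d \<in> S \<Longrightarrow> 0 \<le> bregman_gap g h p d"
  using below_tangent[of p d] by (simp add: bregman_gap_def)

text \<open>The increase is \<open>bregman_gap g h w d + (d - w) * (h p - h w)\<close>, a sum of two
  nonnegative terms.\<close>

lemma bregman_gap_mono_action: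
  assumes "p \<in> S" "w \<in> S" "d \<in> S" "w \<in> closed_segment p d"
  shows "bregman_gap g h p w \<le> bregman_gap g h p d"
proof -
  have "(d - w) * h w \<le> (d - w) * h p"
    using assms decreasing[of p w] decreasing[of w p]
    by (auto simp: closed_segment_eq_real_ivl mult_left_mono mult_left_mono_neg split: if_splits)
  then show ?thesis
    using below_tangent[of w d] assms by (simp add: bregman_gap_def algebra_simps)
qed

text \<open>Here the increase is \<open>bregman_gap g h u p + (w - p) * (h u - h p)\<close>.\<close>

lemma bregman_gap_mono_parameter:
  assumes "u \<in> S" "p \<in> S" "w \<in> S" "p \<in> closed_segment u w"
  shows "bregman_gap g h p w \<le> bregman_gap g h u w"
proof -
  have "0 \<le> (w - p) * (h u - h p)"
    using assms decreasing[of u p] decreasing[of p u]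
    by (auto simp: closed_segment_eq_real_ivl mult_nonpos_nonpos split: if_splits)
  then show ?thesis
    using below_tangent[of u p] assms by (simp add: bregman_gap_def algebra_simps)
qed

text \<open>Darboux's theorem: a derivative takes intermediate values even if it is not
  continuous.\<close>

lemma derivative_intermediate_value:
  assumes a: "a \<in> S" and b: "b \<in> S" and le: "h b \<le> e" "e \<le> h a"
  shows "e \<in> h ` S"
proof (cases "h a = e \<or> h b = e")
  case True
  then show ?thesis using a b by blast
next
  case False
  with le have lt: "h b < e" "e < h a" by auto
  then have "a < b"
    using decreasing[OF b a] by linarith
  \<comment> \<open>Tilting by the slope \<open>e\<close> reduces the claim to a critical point of
    \<open>G\<close>, found at a maximum.\<close>
  define G where "G y = g y - e * y" for y
  have G: "(G has_real_derivative h y - e) (at y within {a..b})" if "y \<in> {a..b}" for y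
    unfolding G_def using that segment_subset[OF a b]
    by (auto intro!: derivative_eq_intros has_field_derivative_subset[OF deriv])
  then have "continuous_on {a..b} G"
    by (rule DERIV_continuous_on)
  then obtain c where c: "c \<in> {a..b}" and max: "\<And>y. y \<in> {a..b} \<Longrightarrow> G y \<le> G c"
    using continuous_attains_sup[of "{a..b}" G] \<open>a < b\<close> by auto
  \<comment> \<open>A positive slope of \<open>G\<close> at \<open>c\<close> rules out
    \<open>c = b\<close>, where the slope is negative, so \<open>G\<close> would still rise to the
    right of \<open>c\<close>. The other inequality mirrors this at \<open>a\<close>.\<close>
  have "h c \<le> e"
  proof (rule ccontr)
    assume "\<not> h c \<le> e"
    then have "c < b" using lt c by (cases "c = b") auto
    obtain \<delta> where "\<delta> > 0" and \<delta>: "\<And>k. 0 < k \<Longrightarrow> c + k \<in> {a..b} \<Longrightarrow> k < \<delta> \<Longrightarrow> G c < G (c + k)"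
      using has_real_derivative_pos_inc_right[OF G[OF c]] \<open>\<not> h c \<le> e\<close> by auto
    define k where "k = min (\<delta> / 2) (b - c)"
    have "0 < k" "c + k \<in> {a..b}" "k < \<delta>"
      using \<open>\<delta> > 0\<close> \<open>c < b\<close> c by (auto simp: k_def min_def)
    then show False using \<delta> max by force
  qed
  moreover have "e \<le> h c"
  proof (rule ccontr)
    assume "\<not> e \<le> h c"
    then have "a < c" using lt c by (cases "c = a") auto
    obtain \<delta> where "\<delta> > 0" and \<delta>: "\<And>k. 0 < k \<Longrightarrow> c - k \<in> {a..b} \<Longrightarrow> k < \<delta> \<Longrightarrow> G c < G (c - k)"
      using has_real_derivative_neg_dec_left[OF G[OF c]] \<open>\<not> e \<le> h c\<close> by auto
    define k where "k = min (\<delta> / 2) (c - a)"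
    have "0 < k" "c - k \<in> {a..b}" "k < \<delta>"
      using \<open>\<delta> > 0\<close> \<open>a < c\<close> c by (auto simp: k_def min_def)
    then show False using \<delta> max by force
  qed
  ultimately show ?thesis
    using c segment_subset[OF a b] by force
qed

lemma bregman_gap_minimax:
  assumes S: "u \<in> S" "v \<in> S" "w \<in> S" "P \<subseteq> S"
    and extreme: "u \<in> P" "v \<in> P" "P \<subseteq> closed_segment u v"
    and w: "w \<in> closed_segment u v" "bregman_gap g h u w = bregman_gap g h v w"
  shows "(SUP p\<in>P. ereal (bregman_gap g h p w)) = (INF d\<in>S. SUP p\<in>P. ereal (bregman_gap g h p d))"
proof (rule antisym)
  show "(SUP p\<in>P. ereal (bregman_gap g h p w)) \<le> (INF d\<in>S. SUP p\<in>P. ereal (bregman_gap g h p d))"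
  proof (rule INF_greatest)
    fix d assume d: "d \<in> S"
    have upper: "bregman_gap g h p w \<le> bregman_gap g h u w" if "p \<in> P" for p
    proof -
      \<comment> \<open>\<open>w\<close> cuts the segment in two, and \<open>p\<close> falls into
        one half.\<close>
      have "p \<in> closed_segment u w \<or> p \<in> closed_segment v w"
        using that extreme w by (auto simp: closed_segment_eq_real_ivl split: if_splits)
      then show ?thesis
        using bregman_gap_mono_parameter[of u p w] bregman_gap_mono_parameter[of v p w] S that w(2)
        by auto
    qed
    \<comment> \<open>Wherever \<open>d\<close> lies, \<open>w\<close> is between it and one of the
      ends; that end becomes \<open>q\<close>.\<close>
    have "w \<in> closed_segment u d \<or> w \<in> closed_segment v d"
      using w by (auto simp: closed_segment_eq_real_ivl split: if_splits)
    then obtain q where q: "q \<in> P" "bregman_gap g h u w \<le> bregman_gap g h q d"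
      using bregman_gap_mono_action S d extreme w(2) by metis
    have "(SUP p\<in>P. ereal (bregman_gap g h p w)) \<le> ereal (bregman_gap g h q d)"
      using upper q by (intro SUP_least) (auto intro: order_trans)
    also have "\<dots> \<le> (SUP p\<in>P. ereal (bregman_gap g h p d))"
      using q by (intro SUP_upper)
    finally show "(SUP p\<in>P. ereal (bregman_gap g h p w)) \<le> (SUP p\<in>P. ereal (bregman_gap g h p d))" .
  qed
qed (use S in \<open>auto intro: INF_lower\<close>)

end

section \<open>Weighted means\<close>

text \<open>A zero integral would make \<open>f * q\<close>, hence \<open>q\<close>, vanish almost
  everywhere on \<open>A\<close>, against its nonzero mass.\<close>

lemma weighted_set_integral_pos:
  fixes f q :: "'a \<Rightarrow> real"
  assumes f: "\<And>y. y \<in> A \<Longrightarrow> 0 < f y" and q: "\<And>y. y \<in> A \<Longrightarrow> 0 \<le> q y"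
    and int: "set_integrable M A (\<lambda>y. f y * q y)" and mass: "(LINT y:A|M. q y) \<noteq> 0"
  shows "0 < (LINT y:A|M. f y * q y)"
proof (rule ccontr)
  let ?F = "\<lambda>y. indicator A y *\<^sub>R (f y * q y)"
  assume "\<not> 0 < (LINT y:A|M. f y * q y)"
  moreover have nonneg: "0 \<le> ?F y" for y
    using f q by (auto simp: indicator_def less_imp_le)
  moreover have "0 \<le> integral\<^sup>L M ?F"
    by (intro Bochner_Integration.integral_nonneg nonneg)
  ultimately have "integral\<^sup>L M ?F = 0"
    unfolding set_lebesgue_integral_def by linarith
  then have "AE y in M. ?F y = 0"
    using integral_nonneg_eq_0_iff_AE[of M ?F] int nonneg by (auto simp: set_integrable_def)
  then have "AE y in M. indicator A y *\<^sub>R q y = 0"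
  proof eventually_elim
    case (elim y)
    then show ?case using f[of y] by (cases "y \<in> A") auto
  qed
  from integral_eq_zero_AE[OF this] show False
    using mass by (simp add: set_lebesgue_integral_def)
qed

text \<open>Otherwise the mean minus \<open>f\<close> is positive on \<open>A\<close> and so is its
  weighted integral, which total weight one makes zero.\<close>

lemma weighted_mean_attained_above:
  fixes f q :: "'a \<Rightarrow> real"
  assumes q: "\<And>y. y \<in> A \<Longrightarrow> 0 \<le> q y" "set_integrable M A q" "(LINT y:A|M. q y) = 1"
    and int: "set_integrable M A (\<lambda>y. f y * q y)"
  shows "\<exists>y\<in>A. (LINT y:A|M. f y * q y) \<le> f y"
proof (rule ccontr)
  let ?e = "LINT y:A|M. f y * q y"
  assume "\<not> ?thesis"
  then have lt: "0 < ?e - f y" if "y \<in> A" for y using that by force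
  have eq: "(\<lambda>y. (?e - f y) * q y) = (\<lambda>y. ?e * q y - f y * q y)"
    by (simp add: left_diff_distrib)
  have "0 < (LINT y:A|M. (?e - f y) * q y)"
    using q int by (intro weighted_set_integral_pos lt) (auto simp: eq)
  then show False
    using q int by (simp add: eq)
qed

lemma weighted_mean_attained_below:
  fixes f q :: "'a \<Rightarrow> real"
  assumes q: "\<And>y. y \<in> A \<Longrightarrow> 0 \<le> q y" "set_integrable M A q" "(LINT y:A|M. q y) = 1"
    and int: "set_integrable M A (\<lambda>y. f y * q y)"
  shows "\<exists>y\<in>A. f y \<le> (LINT y:A|M. f y * q y)"
proof -
  have "set_integrable M A (\<lambda>y. - f y * q y)"
    using int by (simp add: set_integrable_def)
  from weighted_mean_attained_above[OF q this] show ?thesis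
    by (simp add: set_lebesgue_integral_def)
qed

section \<open>Posterior regret in the exponential family\<close>

locale exponential_family =
  fixes \<nu> :: "real measure" and \<Theta> :: "real set" and \<beta> t r :: "real \<Rightarrow> real"
  assumes par_space: "is_interval \<Theta>"
    and weight_pos: "\<And>\<theta> x. \<theta> \<in> \<Theta> \<Longrightarrow> x \<in> space \<nu> \<Longrightarrow> 0 < \<beta> \<theta> * t x"
    and normalized: "\<And>\<theta>. \<theta> \<in> \<Theta> \<Longrightarrow> prob_space (sampling_distribution \<nu> \<beta> t r \<theta>)"
    and differentiable: "\<beta> differentiable_on \<Theta>"
    and integrable_r: "\<And>\<theta>. \<theta> \<in> \<Theta> \<Longrightarrow> integrable (sampling_distribution \<nu> \<beta> t r \<theta>) r"
    and mean_r: "\<And>\<theta>. \<theta> \<in> \<Theta> \<Longrightarrow> H_fun \<Theta> \<beta> \<theta> = (\<integral>x. r x \<partial>sampling_distribution \<nu> \<beta> t r \<theta>)"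
    and H_decreasing: "strict_antimono_on \<Theta> (H_fun \<Theta> \<beta>)"
begin

abbreviation "H \<equiv> H_fun \<Theta> \<beta>"

\<comment> \<open>\<open>\<beta>\<close> has the constant sign of \<open>t\<close>, possibly negative, so \<open>ln \<circ> \<beta>\<close> itself may be a junk value.\<close>
abbreviation "log_\<beta> \<equiv> \<lambda>\<theta>. ln \<bar>\<beta> \<theta>\<bar>"

abbreviation "gap \<equiv> bregman_gap log_\<beta> H"

lemma space_nonempty: "\<theta> \<in> \<Theta> \<Longrightarrow> space \<nu> \<noteq> {}"
  using prob_space.not_empty[OF normalized] by (simp add: sampling_distribution_def)

text \<open>Both values share the sign of \<open>t\<close> at any observation, and a probability
  space has at least one.\<close>

lemma \<beta>_quotient_pos: "\<theta> \<in> \<Theta> \<Longrightarrow> d \<in> \<Theta> \<Longrightarrow> 0 < \<beta> \<theta> / \<beta> d"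
  using space_nonempty[of \<theta>] weight_pos[of \<theta>] weight_pos[of d]
  by (fastforce simp: zero_less_mult_iff zero_less_divide_iff)

lemma \<beta>_nonzero: "\<theta> \<in> \<Theta> \<Longrightarrow> \<beta> \<theta> \<noteq> 0"
  using \<beta>_quotient_pos[of \<theta> \<theta>] by auto

lemma ln_\<beta>_quotient:
  assumes "\<theta> \<in> \<Theta>" "d \<in> \<Theta>"
  shows "ln (\<beta> \<theta> / \<beta> d) = log_\<beta> \<theta> - log_\<beta> d"
proof -
  have "\<beta> \<theta> / \<beta> d = \<bar>\<beta> \<theta>\<bar> / \<bar>\<beta> d\<bar>"
    using \<beta>_quotient_pos[OF assms] by (simp flip: abs_divide)
  then show ?thesis
    using assms \<beta>_nonzero by (simp add: ln_div)
qed

lemma log_\<beta>_has_derivative: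
  assumes \<theta>: "\<theta> \<in> \<Theta>"
  shows "(log_\<beta> has_real_derivative H \<theta>) (at \<theta> within \<Theta>)"
proof -
  \<comment> \<open>The factor is the common sign of \<open>\<beta>\<close> on
    \<open>\<Theta>\<close>; it makes the argument of \<open>ln\<close> positive and cancels in the
    logarithmic derivative.\<close>
  have pos: "0 < sgn (\<beta> \<theta>) * \<beta> y" if "y \<in> \<Theta>" for y
    using \<beta>_quotient_pos[OF \<theta> that] by (auto simp: sgn_if zero_less_divide_iff)
  have "(\<beta> has_real_derivative vector_derivative \<beta> (at \<theta> within \<Theta>)) (at \<theta> within \<Theta>)"
    using differentiable \<theta>
    by (simp add: differentiable_on_def vector_derivative_works has_real_derivative_iff_has_vector_derivative)
  then have "((\<lambda>y. ln (sgn (\<beta> \<theta>) * \<beta> y)) has_real_derivative H \<theta>) (at \<theta> within \<Theta>)"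
    using pos[OF \<theta>] by (auto intro!: derivative_eq_intros simp: H_fun_def sgn_if)
  moreover have "ln (sgn (\<beta> \<theta>) * \<beta> y) = log_\<beta> y" if "y \<in> \<Theta>" for y
    using pos[OF that] by (auto simp: sgn_if split: if_splits)
  ultimately show ?thesis
    using \<theta> by (auto elim: has_field_derivative_transform_within[where d = 1])
qed

sublocale decreasing_derivative \<Theta> log_\<beta> H
  by unfold_locales (use par_space log_\<beta>_has_derivative H_decreasing in auto)

text \<open>\<open>t\<close> cancels in the likelihood ratio, whose logarithm is thus affine in
  \<open>r\<close>, and \<open>r\<close> has mean \<open>H \<theta>\<close>.\<close>

lemma intrinsic_loss_eq_gap:
  assumes \<theta>: "\<theta> \<in> \<Theta>" and d: "d \<in> \<Theta>"
  shows "intrinsic_loss \<nu> \<beta> t r \<theta> d = gap \<theta> d"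
proof -
  interpret prob_space "sampling_distribution \<nu> \<beta> t r \<theta>"
    using normalized[OF \<theta>] .
  have "ln (expfam_density \<beta> t r \<theta> y / expfam_density \<beta> t r d y) = ln (\<beta> \<theta> / \<beta> d) + (d - \<theta>) * r y"
    if "y \<in> space \<nu>" for y
  proof -
    have "t y \<noteq> 0" using weight_pos[OF \<theta> that] by auto
    then have "expfam_density \<beta> t r \<theta> y / expfam_density \<beta> t r d y
        = \<beta> \<theta> / \<beta> d * exp ((d - \<theta>) * r y)"
      using \<beta>_nonzero[OF d] by (simp add: expfam_density_def field_simps flip: exp_add)
    then show ?thesis
      using \<beta>_quotient_pos[OF \<theta> d] by (simp only: ln_mult_pos[OF _ exp_gt_zero] ln_exp)
  qed
  then have "intrinsic_loss \<nu> \<beta> t r \<theta> d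
      = expectation (\<lambda>y. ln (\<beta> \<theta> / \<beta> d) + (d - \<theta>) * r y)"
    unfolding intrinsic_loss_def
    by (intro Bochner_Integration.integral_cong) (auto simp: sampling_distribution_def)
  also have "\<dots> = ln (\<beta> \<theta> / \<beta> d) + (d - \<theta>) * H \<theta>"
    using integrable_r[OF \<theta>] mean_r[OF \<theta>] prob_space by simp
  finally show ?thesis
    using ln_\<beta>_quotient[OF \<theta> d] by (simp add: bregman_gap_def)
qed

text \<open>Both gaps contain the same logarithm of the action, so their equality is linear in the
  action, with coefficient \<open>H u - H v\<close>.\<close>

lemma equal_regret_action_gap:
  assumes "u \<in> \<Theta>" "v \<in> \<Theta>" "u \<noteq> v"
  shows "gap u (equal_regret_action \<Theta> \<beta> u v) = gap v (equal_regret_action \<Theta> \<beta> u v)"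
proof -
  define w where "w = equal_regret_action \<Theta> \<beta> u v"
  have "H u - H v \<noteq> 0"
    using inj_on_derivative assms by (auto dest: inj_onD)
  then have "w * (H u - H v) = u * H u - v * H v - (log_\<beta> u - log_\<beta> v)"
    using ln_\<beta>_quotient[OF assms(1,2)] by (simp add: w_def equal_regret_action_def)
  then show ?thesis
    unfolding w_def[symmetric] by (simp add: bregman_gap_def algebra_simps)
qed

end

section \<open>The posterior of one prior at one observation\<close>

locale exponential_family_posterior = exponential_family +
  fixes p :: "real \<Rightarrow> real" and x :: real
  assumes observation: "x \<in> space \<nu>"
    and prior_nonneg: "\<And>\<theta>. \<theta> \<in> \<Theta> \<Longrightarrow> 0 \<le> p \<theta>"
    and prior_mass: "(LINT \<theta>:\<Theta>|lborel. p \<theta>) = 1"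
    and posterior_exists: "set_integrable lborel \<Theta> (\<lambda>\<theta>. expfam_density \<beta> t r \<theta> x * p \<theta>)"
    and risk_exists: "\<And>d. d \<in> \<Theta> \<Longrightarrow>
      set_integrable lborel \<Theta> (\<lambda>\<theta>. intrinsic_loss \<nu> \<beta> t r \<theta> d * posterior_density \<Theta> \<beta> t r p x \<theta>)"
begin

abbreviation "post \<equiv> posterior_density \<Theta> \<beta> t r p x"
abbreviation "bayes \<equiv> bayes_estimator \<Theta> \<beta> t r p x"

lemma likelihood_pos: "\<theta> \<in> \<Theta> \<Longrightarrow> 0 < expfam_density \<beta> t r \<theta> x"
  using weight_pos[OF _ observation] by (simp add: expfam_density_def)

lemma evidence_pos: "0 < (LINT \<theta>:\<Theta>|lborel. expfam_density \<beta> t r \<theta> x * p \<theta>)"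
  using likelihood_pos prior_nonneg posterior_exists prior_mass
  by (intro weighted_set_integral_pos) auto

lemma post_nonneg: "\<theta> \<in> \<Theta> \<Longrightarrow> 0 \<le> post \<theta>"
  using likelihood_pos prior_nonneg evidence_pos
  by (simp add: posterior_density_def less_imp_le)

lemma post_integrable: "set_integrable lborel \<Theta> post"
  unfolding posterior_density_def using posterior_exists by simp

lemma post_mass: "(LINT \<theta>:\<Theta>|lborel. post \<theta>) = 1"
  unfolding posterior_density_def using evidence_pos by simp

text \<open>A set with at most one point is Lebesgue null and cannot carry prior mass one.\<close>

lemma two_parameters:
  obtains d d' where "d \<in> \<Theta>" "d' \<in> \<Theta>" "d \<noteq> d'"
proof (rule ccontr)
  assume "\<not> thesis"
  with that have "\<Theta> = {} \<or> (\<exists>c. \<Theta> = {c})" by blast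
  then have "finite \<Theta>" by auto
  then have "AE \<theta> in lborel. \<theta> \<notin> \<Theta>"
    by (intro AE_not_in finite_imp_null_set_lborel)
  then have "AE \<theta> in lborel. indicator \<Theta> \<theta> *\<^sub>R p \<theta> = 0"
    by eventually_elim simp
  from integral_eq_zero_AE[OF this] show False
    using prior_mass by (simp add: set_lebesgue_integral_def)
qed

text \<open>The loss is affine in \<open>H \<theta>\<close> with slope depending on the action, so the existence of the risk at
  two distinct actions yields the existence of the posterior mean of \<open>H\<close>.\<close>

lemma H_post_integrable: "set_integrable lborel \<Theta> (\<lambda>\<theta>. H \<theta> * post \<theta>)"
proof -
  obtain d d' where d: "d \<in> \<Theta>" "d' \<in> \<Theta>" "d \<noteq> d'"
    using two_parameters .
  have eq: "((intrinsic_loss \<nu> \<beta> t r \<theta> d * post \<theta> - intrinsic_loss \<nu> \<beta> t r \<theta> d' * post \<theta>)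
      - (log_\<beta> d' - log_\<beta> d) * post \<theta>) / (d - d') = H \<theta> * post \<theta>" if "\<theta> \<in> \<Theta>" for \<theta>
    using d that by (simp add: intrinsic_loss_eq_gap bregman_gap_def divide_simps)
      (simp add: algebra_simps)
  have "set_integrable lborel \<Theta> (\<lambda>\<theta>. ((intrinsic_loss \<nu> \<beta> t r \<theta> d * post \<theta>
      - intrinsic_loss \<nu> \<beta> t r \<theta> d' * post \<theta>) - (log_\<beta> d' - log_\<beta> d) * post \<theta>) / (d - d'))"
    using d by (intro set_integrable_divide set_integral_diff set_integrable_mult_right
        risk_exists post_integrable)
  then show ?thesis
    using eq by (simp cong: set_integrable_cong)
qed

text \<open>\<open>inv_into\<close> inverts \<open>H\<close> only on its range. Values of
  \<open>H\<close> lie on both sides of the posterior mean, so Darboux puts the mean there.\<close>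

lemma bayes:
  shows bayes_in_parameters: "bayes \<in> \<Theta>"
    and H_bayes: "H bayes = (LINT \<theta>:\<Theta>|lborel. H \<theta> * post \<theta>)"
proof -
  note mean = post_nonneg post_integrable post_mass H_post_integrable
  have "(LINT \<theta>:\<Theta>|lborel. H \<theta> * post \<theta>) \<in> H ` \<Theta>"
    using weighted_mean_attained_above[OF mean] weighted_mean_attained_below[OF mean]
      derivative_intermediate_value by blast
  then show "bayes \<in> \<Theta>" "H bayes = (LINT \<theta>:\<Theta>|lborel. H \<theta> * post \<theta>)"
    unfolding bayes_estimator_def posterior_expectation_def
    by (auto intro: inv_into_into f_inv_into_f)
qed

text \<open>In the loss difference \<open>log_\<beta> \<theta>\<close> cancels; the rest is affine
  in \<open>H \<theta>\<close>, whose posterior mean is \<open>H bayes\<close>.\<close>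

lemma posterior_regret_eq_gap:
  assumes d: "d \<in> \<Theta>"
  shows "posterior_regret \<nu> \<Theta> \<beta> t r p x d = gap bayes d"
proof -
  let ?L = "\<lambda>d \<theta>. intrinsic_loss \<nu> \<beta> t r \<theta> d * post \<theta>"
  have meas: "\<Theta> \<in> sets lborel"
    using real_interval_borel_measurable[OF par_space] by simp
  have "posterior_regret \<nu> \<Theta> \<beta> t r p x d = (LINT \<theta>:\<Theta>|lborel. ?L d \<theta> - ?L bayes \<theta>)"
    unfolding posterior_regret_def posterior_risk_def posterior_expectation_def
    using risk_exists[OF d] risk_exists[OF bayes_in_parameters] by simp
  also have "\<dots> = (LINT \<theta>:\<Theta>|lborel.
      (log_\<beta> bayes - log_\<beta> d) * post \<theta> + (d - bayes) * (H \<theta> * post \<theta>))"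
    using d bayes_in_parameters meas
    by (intro set_lebesgue_integral_cong)
      (auto simp: intrinsic_loss_eq_gap bregman_gap_def algebra_simps)
  also have "\<dots> = (log_\<beta> bayes - log_\<beta> d) + (d - bayes) * H bayes"
    using post_integrable H_post_integrable post_mass
    by (subst set_integral_add) (auto simp: H_bayes)
  finally show ?thesis by (simp add: bregman_gap_def)
qed

lemma bayes_minimizes_risk:
  "is_arg_min (posterior_risk \<nu> \<Theta> \<beta> t r p x) (\<lambda>d. d \<in> \<Theta>) bayes"
  using bayes_in_parameters posterior_regret_eq_gap bregman_gap_nonneg
  by (force simp: is_arg_min_linorder posterior_regret_def)

end

section \<open>From the differential equation to minimaxity at every observation\<close>

theorem lemma6:
  fixes X \<Theta> J :: "real set" and \<nu> :: "real measure"
    and \<beta> t r H :: "real \<Rightarrow> real"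
    and \<alpha>1 \<alpha>2 :: real
    and \<pi> :: "real \<Rightarrow> real \<Rightarrow> real"
    and \<Psi> :: "real \<Rightarrow> real \<Rightarrow> real"
    and D :: "real \<Rightarrow> real"
  defines "H \<equiv> H_fun \<Theta> \<beta>"
    and "\<Psi> \<equiv> (\<lambda>\<alpha> x. bayes_estimator \<Theta> \<beta> t r (\<pi> \<alpha>) x)"
    and "D \<equiv> (\<lambda>x. equal_regret_action \<Theta> \<beta> (\<Psi> \<alpha>1 x) (\<Psi> \<alpha>2 x))"
    and "J \<equiv> convex hull X"
    \<comment> \<open>the exponential family; \<open>J\<close> is the range over which the observation is differentiated
        (\<open>J = X\<close> if \<open>X\<close> is an interval, while \<open>J\<close> fills the gaps if \<open>X\<close> is discrete)\<close>
  assumes sample_space: "X \<in> sets borel"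
    and ref_measure: "\<nu> = restrict_space lborel X \<or> \<nu> = count_space X"
    and par_space: "is_interval \<Theta>"
    and t_meas: "t \<in> borel_measurable \<nu>"
    and r_meas: "r \<in> borel_measurable \<nu>"
    and r_pos: "\<And>x. x \<in> X \<Longrightarrow> 0 < r x"
    and \<beta>t_pos: "\<And>\<theta> x. \<theta> \<in> \<Theta> \<Longrightarrow> x \<in> X \<Longrightarrow> 0 < \<beta> \<theta> * t x"
    and normalized: "\<And>\<theta>. \<theta> \<in> \<Theta> \<Longrightarrow> prob_space (sampling_distribution \<nu> \<beta> t r \<theta>)"
    and \<beta>_diff: "\<beta> differentiable_on \<Theta>"
    and r_integrable: "\<And>\<theta>. \<theta> \<in> \<Theta> \<Longrightarrow> integrable (sampling_distribution \<nu> \<beta> t r \<theta>) r"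
    and H_mean: "\<And>\<theta>. \<theta> \<in> \<Theta> \<Longrightarrow> H \<theta> = (\<integral>x. r x \<partial>sampling_distribution \<nu> \<beta> t r \<theta>)"
    and H_decreasing: "strict_antimono_on \<Theta> H"
    \<comment> \<open>the class of priors\<close>
    and hyper: "\<alpha>1 \<le> \<alpha>2"
    and prior_nonneg: "\<And>\<alpha> \<theta>. \<alpha> \<in> {\<alpha>1..\<alpha>2} \<Longrightarrow> \<theta> \<in> \<Theta> \<Longrightarrow> 0 \<le> \<pi> \<alpha> \<theta>"
    and prior_integrable: "\<And>\<alpha>. \<alpha> \<in> {\<alpha>1..\<alpha>2} \<Longrightarrow> set_integrable lborel \<Theta> (\<pi> \<alpha>)"
    and prior_mass: "\<And>\<alpha>. \<alpha> \<in> {\<alpha>1..\<alpha>2} \<Longrightarrow> (LINT \<theta>:\<Theta>|lborel. \<pi> \<alpha> \<theta>) = 1"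
    \<comment> \<open>the posteriors and the posterior risks exist\<close>
    and posterior_exists: "\<And>\<alpha> x. \<alpha> \<in> {\<alpha>1..\<alpha>2} \<Longrightarrow> x \<in> X \<Longrightarrow>
          set_integrable lborel \<Theta> (\<lambda>\<theta>. expfam_density \<beta> t r \<theta> x * \<pi> \<alpha> \<theta>)"
    and risk_exists: "\<And>\<alpha> x d. \<alpha> \<in> {\<alpha>1..\<alpha>2} \<Longrightarrow> x \<in> X \<Longrightarrow> d \<in> \<Theta> \<Longrightarrow>
          set_integrable lborel \<Theta>
            (\<lambda>\<theta>. intrinsic_loss \<nu> \<beta> t r \<theta> d * posterior_density \<Theta> \<beta> t r (\<pi> \<alpha>) x \<theta>)"
    and \<Psi>_diff: "(\<lambda>(\<alpha>, x). \<Psi> \<alpha> x) differentiable_on ({\<alpha>1..\<alpha>2} \<times> J)"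
    and H_integrable: "\<And>x. x \<in> X \<Longrightarrow>
          set_integrable lborel \<Theta> (\<lambda>\<theta>. \<bar>H \<theta>\<bar> * expfam_density \<beta> t r \<theta> x)"
    and prior_continuous: "\<And>a \<alpha>. range a \<subseteq> {\<alpha>1..\<alpha>2} \<Longrightarrow> \<alpha> \<in> {\<alpha>1..\<alpha>2} \<Longrightarrow> a \<longlonglongrightarrow> \<alpha> \<Longrightarrow>
          (\<lambda>n. SUP \<theta>\<in>\<Theta>. ereal \<bar>\<pi> (a n) \<theta> - \<pi> \<alpha> \<theta>\<bar>) \<longlonglongrightarrow> 0"
    \<comment> \<open>\<open>\<alpha>1\<close> and \<open>\<alpha>2\<close> give the extreme Bayes estimates\<close>
    and extremes: "\<And>\<alpha> x. \<alpha> \<in> {\<alpha>1..\<alpha>2} \<Longrightarrow> x \<in> X \<Longrightarrow>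
          \<Psi> \<alpha> x \<in> closed_segment (\<Psi> \<alpha>1 x) (\<Psi> \<alpha>2 x)"
    \<comment> \<open>a constant solution of the differential equation, the constant of integration
        between \<open>\<Psi> \<alpha>\<close> and \<open>D\<close> being zero\<close>
    and constant_solution: "\<exists>\<alpha>\<in>{\<alpha>1..\<alpha>2}.
          (\<forall>x\<in>J. \<exists>d. (\<Psi> \<alpha> has_real_derivative d) (at x within J) \<and>
                     (D has_real_derivative d) (at x within J)) \<and>
          (\<exists>x0\<in>J. \<Psi> \<alpha> x0 = D x0)"
  shows "\<exists>\<alpha>\<in>{\<alpha>1..\<alpha>2}.
    (\<forall>x\<in>X. is_arg_min (posterior_risk \<nu> \<Theta> \<beta> t r (\<pi> \<alpha>) x) (\<lambda>d. d \<in> \<Theta>) (\<Psi> \<alpha> x)) \<and>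
    is_PRGM \<nu> \<Theta> \<beta> t r (\<pi> ` {\<alpha>1..\<alpha>2}) (\<Psi> \<alpha>)"
proof -
  have space: "space \<nu> = X"
    using ref_measure by (auto simp: space_restrict_space)
  interpret exponential_family \<nu> \<Theta> \<beta> t r
    unfolding exponential_family_def space
    using par_space \<beta>t_pos normalized \<beta>_diff r_integrable H_mean H_decreasing
    unfolding H_def by blast
  have posterior: "exponential_family_posterior \<nu> \<Theta> \<beta> t r (\<pi> \<alpha>) x"
    if "\<alpha> \<in> {\<alpha>1..\<alpha>2}" "x \<in> X" for \<alpha> x
    using that prior_nonneg prior_mass posterior_exists risk_exists
    by unfold_locales (auto simp: space)
  have \<Psi>_in: "\<Psi> \<alpha> x \<in> \<Theta>" if "\<alpha> \<in> {\<alpha>1..\<alpha>2}" "x \<in> X" for \<alpha> x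
    using exponential_family_posterior.bayes_in_parameters[OF posterior[OF that]]
    by (simp add: \<Psi>_def)
  have regret: "posterior_regret \<nu> \<Theta> \<beta> t r (\<pi> \<alpha>) x d
      = bregman_gap (\<lambda>\<theta>. ln \<bar>\<beta> \<theta>\<bar>) (H_fun \<Theta> \<beta>) (\<Psi> \<alpha> x) d"
    if "\<alpha> \<in> {\<alpha>1..\<alpha>2}" "x \<in> X" "d \<in> \<Theta>" for \<alpha> x d
    using exponential_family_posterior.posterior_regret_eq_gap[OF posterior[OF that(1,2)] that(3)]
    by (simp add: \<Psi>_def)
  obtain \<alpha> x0 where \<alpha>: "\<alpha> \<in> {\<alpha>1..\<alpha>2}"
    and ode: "\<And>x. x \<in> J \<Longrightarrow> \<exists>d. (\<Psi> \<alpha> has_real_derivative d) (at x within J) \<and>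
                     (D has_real_derivative d) (at x within J)"
    and x0: "x0 \<in> J" "\<Psi> \<alpha> x0 = D x0"
    using constant_solution by auto
  \<comment> \<open>Zero derivative forces constancy because \<open>J\<close> is convex, while
    \<open>X\<close> may have gaps; \<open>x0\<close> then makes the constant zero, even if it lies
    outside \<open>X\<close>.\<close>
  have "((\<lambda>x. \<Psi> \<alpha> x - D x) has_real_derivative 0) (at x within J)" if "x \<in> J" for x
    using ode[OF that] by (auto intro!: derivative_eq_intros)
  then obtain c where "\<And>x. x \<in> J \<Longrightarrow> \<Psi> \<alpha> x - D x = c"
    using has_field_derivative_zero_constant[of J "\<lambda>x. \<Psi> \<alpha> x - D x"]
    by (auto simp: J_def)
  with x0 have \<Psi>_eq_D: "\<Psi> \<alpha> x = D x" if "x \<in> X" for x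
    using hull_inc[OF that, of convex] unfolding J_def
    by (metis eq_iff_diff_eq_0)
  have minimax: "(SUP p\<in>\<pi> ` {\<alpha>1..\<alpha>2}. ereal (posterior_regret \<nu> \<Theta> \<beta> t r p x (\<Psi> \<alpha> x)))
      = (INF d\<in>\<Theta>. SUP p\<in>\<pi> ` {\<alpha>1..\<alpha>2}. ereal (posterior_regret \<nu> \<Theta> \<beta> t r p x d))"
    if x: "x \<in> X" for x
  proof -
    let ?u = "\<Psi> \<alpha>1 x" and ?v = "\<Psi> \<alpha>2 x" and ?P = "(\<lambda>\<alpha>. \<Psi> \<alpha> x) ` {\<alpha>1..\<alpha>2}"
    \<comment> \<open>The regret depends on the prior only through its Bayes estimate, so the
      supremum may run over estimates.\<close>
    have sup: "(SUP p\<in>\<pi> ` {\<alpha>1..\<alpha>2}. ereal (posterior_regret \<nu> \<Theta> \<beta> t r p x d))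
        = (SUP p\<in>?P. ereal (bregman_gap (\<lambda>\<theta>. ln \<bar>\<beta> \<theta>\<bar>) (H_fun \<Theta> \<beta>) p d))" if "d \<in> \<Theta>" for d
      unfolding image_image using regret x that by (intro SUP_cong) auto
    have "gap ?u (\<Psi> \<alpha> x) = gap ?v (\<Psi> \<alpha> x)"
    \<comment> \<open>For equal extremes \<open>D x\<close> is the default value 0 of a division by
      zero, but the two gaps coincide trivially.\<close>
    proof (cases "?u = ?v")
      case False
      then show ?thesis
        using equal_regret_action_gap[OF \<Psi>_in \<Psi>_in, of \<alpha>1 x \<alpha>2 x] x hyper
        by (simp add: \<Psi>_eq_D D_def)
    qed simp
    \<comment> \<open>\<open>extremes\<close> places all estimates, and with them the action
      \<open>\<Psi> \<alpha> x\<close>, between \<open>?u\<close> and \<open>?v\<close>.\<close>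
    then have "(SUP p\<in>?P. ereal (gap p (\<Psi> \<alpha> x))) = (INF d\<in>\<Theta>. SUP p\<in>?P. ereal (gap p d))"
      using \<Psi>_in x \<alpha> hyper extremes
      by (intro bregman_gap_minimax[where u = ?u and v = ?v]) auto
    then show ?thesis
      using sup \<Psi>_in[OF \<alpha> x] by (simp cong: INF_cong)
  qed
  have "is_arg_min (posterior_risk \<nu> \<Theta> \<beta> t r (\<pi> \<alpha>) x) (\<lambda>d. d \<in> \<Theta>) (\<Psi> \<alpha> x)" if "x \<in> X" for x
    using exponential_family_posterior.bayes_minimizes_risk[OF posterior[OF \<alpha> that]]
    by (simp add: \<Psi>_def)
  moreover have "is_PRGM \<nu> \<Theta> \<beta> t r (\<pi> ` {\<alpha>1..\<alpha>2}) (\<Psi> \<alpha>)"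
    unfolding is_PRGM_def space using minimax \<Psi>_in[OF \<alpha>] by auto
  ultimately show ?thesis
    using \<alpha> by blast
qed

end
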